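(* Let $X$ and $Y$ be linear spaces over a field $\mathbb{K}$, let $\alpha_{1},\beta_{1}\in\mathbb{K}$ be non-zero, let $\gamma_{1,1},\gamma_{1,2},\gamma_{2,1},\gamma_{2,2}\in \mathbb{K}$ be given constants, and let $f\colon X\times Y\to \mathbb{K}$ be a function with $f(0,0)=0$. Then \[ f(\alpha_{1}x_{1},\beta_{1}y_{1})=\gamma_{1,1}f(x_{1},y_{1})+\gamma_{1,2}f(x_{1},y_{2})+\gamma_{2,1}f(x_{2},y_{1})+\gamma_{2,2}f(x_{2},y_{2}) \qquad (x_{1}, x_{2}\in X,\ y_{1}, y_{2}\in Y) \] holds if and only if one of the following alternatives holds. (A) $\gamma_{1,2}=\gamma_{2,1}=\gamma_{2,2}=0$ and $f$ is an arbitrary function fulfilling \[ f(\alpha_{1}x,\beta_{1}y)=\gamma_{1,1}f(x,y) \qquad (x\in X,\ y\in Y). \] (B) There exist functions $\chi\colon X\to\mathbb{K}$ and $\zeta\colon Y\to \mathbb{K}$ vanishing at zero such that \[ f(x,y)=\chi(x)+\zeta(y) \qquad (x\in X,\ y\in Y), \] \[ \chi(\alpha_{1}x)=(\gamma_{1,1}+\gamma_{1,2})\chi(x),\qquad \zeta(\beta_{1}z)=(\gamma_{1,1}+\gamma_{2,1})\zeta(z) \qquad (x\in X,\ z\in Y), \] and (i) either $\gamma_{2,1}+\gamma_{2,2}=0$ or $\chi$ is identically zero; (ii) either $\gamma_{1,2}+\gamma_{2,2}=0$ or $\zeta$ is identically zero.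
   Context: All "either ... or" alternatives are inclusive. *)

theory Defs
  imports Complex_Main
begin

end

theory Submission
  imports Defs
begin

text \<open>
  The left-hand side of the equation does not involve \<open>x\<^sub>2\<close> and \<open>y\<^sub>2\<close>, so the right-hand side is
  unchanged when they are replaced by 0. Putting some of the remaining arguments to 0 in this
  comparison shows that each of \<open>\<gamma>\<^sub>1\<^sub>2\<close>, \<open>\<gamma>\<^sub>2\<^sub>1\<close>, \<open>\<gamma>\<^sub>2\<^sub>2\<close> annihilates the mixed difference
  \<open>f (x, y) - f (x, 0) - f (0, y)\<close> (\<open>coefficients_annihilate\<close>).
  If all three coefficients are 0, the equation is the homogeneity in (A). If one of them is not 0,
  the mixed difference vanishes identically, so \<open>f\<close> is a sum of a function of \<open>x\<close> and a function
  of \<open>y\<close>, and restricting the equation to the two axes gives the conditions in (B).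
  The converse for (B) is a direct computation (\<open>separated_solution\<close>).

  Restricting to the axes works because the scalings by \<open>\<alpha>\<^sub>1\<close> and \<open>\<beta>\<^sub>1\<close> fix the origin and so map
  each axis to itself. The other steps do not look inside the scalings, so the lemmas have self-maps \<open>a\<close>, \<open>b\<close>
  in their place.
\<close>

text \<open>
  The comparison of the equation at \<open>(x\<^sub>1, x\<^sub>2, y\<^sub>1, y\<^sub>2)\<close> and at \<open>(x\<^sub>1, 0, y\<^sub>1, 0)\<close> is a relation that
  no longer involves \<open>a\<close>, \<open>b\<close> and \<open>c\<^sub>1\<^sub>1\<close>. With two of the four arguments equal to 0 it expresses each
  \<open>c * f (x, y)\<close> through the values of \<open>f\<close> on the axes. The first two conclusions, the cases with a
  single nonzero argument, are what turns these values into \<open>c * (f (x, 0) + f (0, y))\<close>.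
\<close>

lemma coefficients_annihilate:
  fixes a :: "'x::zero \<Rightarrow> 'x" and b :: "'y::zero \<Rightarrow> 'y"
    and f :: "'x \<times> 'y \<Rightarrow> 'k::field"
  assumes f0: "f (0, 0) = 0"
    and eq: "\<And>x\<^sub>1 x\<^sub>2 y\<^sub>1 y\<^sub>2. f (a x\<^sub>1, b y\<^sub>1) =
      c\<^sub>1\<^sub>1 * f (x\<^sub>1, y\<^sub>1) + c\<^sub>1\<^sub>2 * f (x\<^sub>1, y\<^sub>2) + c\<^sub>2\<^sub>1 * f (x\<^sub>2, y\<^sub>1) + c\<^sub>2\<^sub>2 * f (x\<^sub>2, y\<^sub>2)"
  shows "(c\<^sub>2\<^sub>1 + c\<^sub>2\<^sub>2) * f (x, 0) = 0"
    and "(c\<^sub>1\<^sub>2 + c\<^sub>2\<^sub>2) * f (0, y) = 0"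
    and "c\<^sub>1\<^sub>2 * (f (x, y) - f (x, 0) - f (0, y)) = 0"
    and "c\<^sub>2\<^sub>1 * (f (x, y) - f (x, 0) - f (0, y)) = 0"
    and "c\<^sub>2\<^sub>2 * (f (x, y) - f (x, 0) - f (0, y)) = 0"
proof -
  have indep: "c\<^sub>1\<^sub>2 * f (x\<^sub>1, y\<^sub>2) + c\<^sub>2\<^sub>1 * f (x\<^sub>2, y\<^sub>1) + c\<^sub>2\<^sub>2 * f (x\<^sub>2, y\<^sub>2)
      = c\<^sub>1\<^sub>2 * f (x\<^sub>1, 0) + c\<^sub>2\<^sub>1 * f (0, y\<^sub>1)" for x\<^sub>1 x\<^sub>2 y\<^sub>1 y\<^sub>2
    using eq[of x\<^sub>1 y\<^sub>1 y\<^sub>2 x\<^sub>2] eq[of x\<^sub>1 y\<^sub>1 0 0] f0 by (simp add: add.assoc)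
  show X: "(c\<^sub>2\<^sub>1 + c\<^sub>2\<^sub>2) * f (x, 0) = 0"
    using indep[of 0 0 x 0] f0 by (simp add: algebra_simps)
  show Y: "(c\<^sub>1\<^sub>2 + c\<^sub>2\<^sub>2) * f (0, y) = 0"
    using indep[of 0 y 0 0] f0 by (simp add: algebra_simps)
  have "c\<^sub>1\<^sub>2 * f (x, y) + c\<^sub>2\<^sub>2 * f (0, y) = c\<^sub>1\<^sub>2 * f (x, 0)"
    using indep[of x y 0 0] f0 by simp
  moreover have "c\<^sub>1\<^sub>2 * (f (x, y) - f (x, 0) - f (0, y)) =
      (c\<^sub>1\<^sub>2 * f (x, y) + c\<^sub>2\<^sub>2 * f (0, y)) - c\<^sub>1\<^sub>2 * f (x, 0) - (c\<^sub>1\<^sub>2 + c\<^sub>2\<^sub>2) * f (0, y)"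
    by (simp add: algebra_simps)
  ultimately show "c\<^sub>1\<^sub>2 * (f (x, y) - f (x, 0) - f (0, y)) = 0"
    using Y by simp
  have "c\<^sub>2\<^sub>1 * f (x, y) + c\<^sub>2\<^sub>2 * f (x, 0) = c\<^sub>2\<^sub>1 * f (0, y)"
    using indep[of 0 0 x y] f0 by simp
  moreover have "c\<^sub>2\<^sub>1 * (f (x, y) - f (x, 0) - f (0, y)) =
      (c\<^sub>2\<^sub>1 * f (x, y) + c\<^sub>2\<^sub>2 * f (x, 0)) - c\<^sub>2\<^sub>1 * f (0, y) - (c\<^sub>2\<^sub>1 + c\<^sub>2\<^sub>2) * f (x, 0)"
    by (simp add: algebra_simps)
  ultimately show "c\<^sub>2\<^sub>1 * (f (x, y) - f (x, 0) - f (0, y)) = 0"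
    using X by simp
  have "c\<^sub>1\<^sub>2 * f (0, y) + c\<^sub>2\<^sub>1 * f (x, 0) + c\<^sub>2\<^sub>2 * f (x, y) = 0"
    using indep[of 0 y x 0] f0 by simp
  moreover have "c\<^sub>2\<^sub>2 * (f (x, y) - f (x, 0) - f (0, y)) =
      (c\<^sub>1\<^sub>2 * f (0, y) + c\<^sub>2\<^sub>1 * f (x, 0) + c\<^sub>2\<^sub>2 * f (x, y))
        - (c\<^sub>2\<^sub>1 + c\<^sub>2\<^sub>2) * f (x, 0) - (c\<^sub>1\<^sub>2 + c\<^sub>2\<^sub>2) * f (0, y)"
    by (simp add: algebra_simps)
  ultimately show "c\<^sub>2\<^sub>2 * (f (x, y) - f (x, 0) - f (0, y)) = 0"
    using X Y by simp
qed

text \<open>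
  Conversely, for an additively separated \<open>f\<close> the right-hand side of the equation consists of the
  two multiples that the scaling conditions produce, and of \<open>(c\<^sub>2\<^sub>1 + c\<^sub>2\<^sub>2) * \<chi> x\<^sub>2\<close> and
  \<open>(c\<^sub>1\<^sub>2 + c\<^sub>2\<^sub>2) * \<zeta> y\<^sub>2\<close>, which the two alternatives make vanish.
\<close>

lemma separated_solution:
  fixes \<chi> :: "'x \<Rightarrow> 'k::field" and \<zeta> :: "'y \<Rightarrow> 'k"
  assumes f: "\<And>x y. f (x, y) = \<chi> x + \<zeta> y"
    and \<chi>: "\<And>x. \<chi> (a x) = (c\<^sub>1\<^sub>1 + c\<^sub>1\<^sub>2) * \<chi> x"
    and \<zeta>: "\<And>y. \<zeta> (b y) = (c\<^sub>1\<^sub>1 + c\<^sub>2\<^sub>1) * \<zeta> y"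
    and "c\<^sub>2\<^sub>1 + c\<^sub>2\<^sub>2 = 0 \<or> (\<forall>x. \<chi> x = 0)"
    and "c\<^sub>1\<^sub>2 + c\<^sub>2\<^sub>2 = 0 \<or> (\<forall>y. \<zeta> y = 0)"
  shows "f (a x\<^sub>1, b y\<^sub>1) =
      c\<^sub>1\<^sub>1 * f (x\<^sub>1, y\<^sub>1) + c\<^sub>1\<^sub>2 * f (x\<^sub>1, y\<^sub>2) + c\<^sub>2\<^sub>1 * f (x\<^sub>2, y\<^sub>1) + c\<^sub>2\<^sub>2 * f (x\<^sub>2, y\<^sub>2)"
proof -
  have "(c\<^sub>2\<^sub>1 + c\<^sub>2\<^sub>2) * \<chi> x\<^sub>2 = 0" and "(c\<^sub>1\<^sub>2 + c\<^sub>2\<^sub>2) * \<zeta> y\<^sub>2 = 0"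
    using assms(4,5) by auto
  moreover have "c\<^sub>1\<^sub>1 * f (x\<^sub>1, y\<^sub>1) + c\<^sub>1\<^sub>2 * f (x\<^sub>1, y\<^sub>2) + c\<^sub>2\<^sub>1 * f (x\<^sub>2, y\<^sub>1) + c\<^sub>2\<^sub>2 * f (x\<^sub>2, y\<^sub>2) =
      f (a x\<^sub>1, b y\<^sub>1) + (c\<^sub>2\<^sub>1 + c\<^sub>2\<^sub>2) * \<chi> x\<^sub>2 + (c\<^sub>1\<^sub>2 + c\<^sub>2\<^sub>2) * \<zeta> y\<^sub>2"
    by (simp add: f \<chi> \<zeta> algebra_simps)
  ultimately show ?thesis
    by (simp only: add_0_right)
qed

theorem proposition13:
  fixes scaleX :: "'k::field \<Rightarrow> 'x::ab_group_add \<Rightarrow> 'x"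
    and scaleY :: "'k \<Rightarrow> 'y::ab_group_add \<Rightarrow> 'y"
    and \<alpha>\<^sub>1 \<beta>\<^sub>1 \<gamma>\<^sub>1\<^sub>1 \<gamma>\<^sub>1\<^sub>2 \<gamma>\<^sub>2\<^sub>1 \<gamma>\<^sub>2\<^sub>2 :: 'k
    and f :: "'x \<times> 'y \<Rightarrow> 'k"
  assumes "vector_space scaleX" and "vector_space scaleY"
    and "\<alpha>\<^sub>1 \<noteq> 0" and "\<beta>\<^sub>1 \<noteq> 0"
    and "f (0, 0) = 0"
  shows "(\<forall>x\<^sub>1 x\<^sub>2 y\<^sub>1 y\<^sub>2.
            f (scaleX \<alpha>\<^sub>1 x\<^sub>1, scaleY \<beta>\<^sub>1 y\<^sub>1) =
              \<gamma>\<^sub>1\<^sub>1 * f (x\<^sub>1, y\<^sub>1) + \<gamma>\<^sub>1\<^sub>2 * f (x\<^sub>1, y\<^sub>2)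
              + \<gamma>\<^sub>2\<^sub>1 * f (x\<^sub>2, y\<^sub>1) + \<gamma>\<^sub>2\<^sub>2 * f (x\<^sub>2, y\<^sub>2))
    \<longleftrightarrow>
      (\<gamma>\<^sub>1\<^sub>2 = 0 \<and> \<gamma>\<^sub>2\<^sub>1 = 0 \<and> \<gamma>\<^sub>2\<^sub>2 = 0 \<and>
        (\<forall>x y. f (scaleX \<alpha>\<^sub>1 x, scaleY \<beta>\<^sub>1 y) = \<gamma>\<^sub>1\<^sub>1 * f (x, y)))
    \<or> (\<exists>(\<chi> :: 'x \<Rightarrow> 'k) (\<zeta> :: 'y \<Rightarrow> 'k).
        \<chi> 0 = 0 \<and> \<zeta> 0 = 0 \<and>
        (\<forall>x y. f (x, y) = \<chi> x + \<zeta> y) \<and>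
        (\<forall>x. \<chi> (scaleX \<alpha>\<^sub>1 x) = (\<gamma>\<^sub>1\<^sub>1 + \<gamma>\<^sub>1\<^sub>2) * \<chi> x) \<and>
        (\<forall>z. \<zeta> (scaleY \<beta>\<^sub>1 z) = (\<gamma>\<^sub>1\<^sub>1 + \<gamma>\<^sub>2\<^sub>1) * \<zeta> z) \<and>
        (\<gamma>\<^sub>2\<^sub>1 + \<gamma>\<^sub>2\<^sub>2 = 0 \<or> (\<forall>x. \<chi> x = 0)) \<and>
        (\<gamma>\<^sub>1\<^sub>2 + \<gamma>\<^sub>2\<^sub>2 = 0 \<or> (\<forall>z. \<zeta> z = 0)))"
    (is "?E \<longleftrightarrow> ?A \<or> ?B")
proof -
  have a0: "scaleX \<alpha>\<^sub>1 0 = 0" and b0: "scaleY \<beta>\<^sub>1 0 = 0"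
    using assms(1,2) by (simp_all add: module.scale_zero_right flip: module_iff_vector_space)
  show ?thesis
  proof
    assume ?E
    then have eq: "f (scaleX \<alpha>\<^sub>1 x\<^sub>1, scaleY \<beta>\<^sub>1 y\<^sub>1) =
        \<gamma>\<^sub>1\<^sub>1 * f (x\<^sub>1, y\<^sub>1) + \<gamma>\<^sub>1\<^sub>2 * f (x\<^sub>1, y\<^sub>2) + \<gamma>\<^sub>2\<^sub>1 * f (x\<^sub>2, y\<^sub>1) + \<gamma>\<^sub>2\<^sub>2 * f (x\<^sub>2, y\<^sub>2)"
      for x\<^sub>1 x\<^sub>2 y\<^sub>1 y\<^sub>2
      by blast
    note ann = coefficients_annihilate[where f = f, OF \<open>f (0, 0) = 0\<close> eq]
    show "?A \<or> ?B"
    proof (cases "\<gamma>\<^sub>1\<^sub>2 = 0 \<and> \<gamma>\<^sub>2\<^sub>1 = 0 \<and> \<gamma>\<^sub>2\<^sub>2 = 0")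
      case True
      with eq show ?thesis by simp
    next
      case False
      then have mixed: "f (x, y) - f (x, 0) - f (0, y) = 0" for x y
        using ann(3-5)[of x y] by auto
      have sep: "f (x, y) = f (x, 0) + f (0, y)" for x y
        using mixed[of x y] by (simp only: diff_diff_eq right_minus_eq)
      have \<chi>: "f (scaleX \<alpha>\<^sub>1 x, 0) = (\<gamma>\<^sub>1\<^sub>1 + \<gamma>\<^sub>1\<^sub>2) * f (x, 0)" for x
        using eq[of x 0 0 0] b0 assms(5) by (simp add: algebra_simps)
      have \<zeta>: "f (0, scaleY \<beta>\<^sub>1 y) = (\<gamma>\<^sub>1\<^sub>1 + \<gamma>\<^sub>2\<^sub>1) * f (0, y)" for y
        using eq[of 0 y 0 0] a0 assms(5) by (simp add: algebra_simps)
      have ?B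
      proof (intro exI[of _ "\<lambda>x. f (x, 0)"] exI[of _ "\<lambda>y. f (0, y)"] conjI allI)
        show "\<gamma>\<^sub>2\<^sub>1 + \<gamma>\<^sub>2\<^sub>2 = 0 \<or> (\<forall>x. f (x, 0) = 0)"
          using ann(1) by (metis mult_eq_0_iff)
        show "\<gamma>\<^sub>1\<^sub>2 + \<gamma>\<^sub>2\<^sub>2 = 0 \<or> (\<forall>y. f (0, y) = 0)"
          using ann(2) by (metis mult_eq_0_iff)
      qed (fact assms(5) sep \<chi> \<zeta>)+
      then show ?thesis ..
    qed
  next
    assume "?A \<or> ?B"
    then show ?E
    proof
      assume ?A
      then show ?E by simp
    next
      assume ?B
      then obtain \<chi> :: "'x \<Rightarrow> 'k" and \<zeta> :: "'y \<Rightarrow> 'k" where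
        "\<And>x y. f (x, y) = \<chi> x + \<zeta> y"
        "\<And>x. \<chi> (scaleX \<alpha>\<^sub>1 x) = (\<gamma>\<^sub>1\<^sub>1 + \<gamma>\<^sub>1\<^sub>2) * \<chi> x"
        "\<And>z. \<zeta> (scaleY \<beta>\<^sub>1 z) = (\<gamma>\<^sub>1\<^sub>1 + \<gamma>\<^sub>2\<^sub>1) * \<zeta> z"
        "\<gamma>\<^sub>2\<^sub>1 + \<gamma>\<^sub>2\<^sub>2 = 0 \<or> (\<forall>x. \<chi> x = 0)"
        "\<gamma>\<^sub>1\<^sub>2 + \<gamma>\<^sub>2\<^sub>2 = 0 \<or> (\<forall>z. \<zeta> z = 0)"
        by blast
      from separated_solution[where f = f, OF this] show ?E
        by blast
    qed
  qed
qed

end
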